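(* Let $X$ be a complete matching, let $\alpha\ge 0$, and let $x=(x_i)_{i\in F}\ge 0$ and $y=(y_j)_{j\in W}\ge 0$ satisfy local financing, i.e. $x_i+\sum_{j\in X_i}y_j=B_i$ for all $i\in F$. Then $(X,x,y)$ belongs to the $\alpha$-core if and only if, for every firm $i\in F$, $$x_i\ge \max_{T\subseteq W}\sum_{j\in T}(\alpha a_{ij}-y_j)=\sum_{j\in W}[\alpha a_{ij}-y_j]_+ .$$ (Here $T$ ranges over all subsets of $W$ and may contain current workers of firm $i$.)
   Context: Market: $F=\{1,\dots,m\}$ is the set of firms, $W=\{1,\dots,n\}$ the set of workers; firm $i$ values worker $j$ at $a_{ij}\ge 0$, and values are additive: $V_i(T)=\sum_{j\in T}a_{ij}$ for $T\subseteq W$. A complete matching $X=(X_1,\dots,X_m)$ is a partition of $W$ (parts may be empty), $X_i$ being the set of workers employed by firm $i$; $B_i=V_i(X_i)$. For $I\subseteq F$, $T\subseteq W$ let $v(I,T)=\sum_{j\in T}\max_{i\in I}a_{ij}$ (and $v(\varnothing,T)=0$). The outcome $(X,x,y)$, with firm profits $x$ and worker wages $y$, is in the $\alpha$-core if $\sum_{i\in I}x_i+\sum_{j\in T}y_j\ge\alpha\, v(I,T)$ for all $I\subseteq F$, $T\subseteq W$. Notation: $[u]_+=\max\{u,0\}$. *)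

theory Defs
  imports Complex_Main "HOL-Library.Disjoint_Sets"
begin

definition firms :: "nat \<Rightarrow> nat set" where
  "firms m = {1..m}"

definition workers :: "nat \<Rightarrow> nat set" where
  "workers n = {1..n}"

definition firm_value :: "(nat \<Rightarrow> nat \<Rightarrow> real) \<Rightarrow> nat \<Rightarrow> nat set \<Rightarrow> real" where
  "firm_value a i T = (\<Sum>j\<in>T. a i j)"

(* A partition indexed by the firms; the parts X i may be empty. *)
definition complete_matching :: "nat \<Rightarrow> nat \<Rightarrow> (nat \<Rightarrow> nat set) \<Rightarrow> bool" where
  "complete_matching m n X \<longleftrightarrow>
     (\<Union>i\<in>firms m. X i) = workers n \<and> disjoint_family_on X (firms m)"

(* The case distinction is needed because Max {} is unspecified. *)
definition coalition_value :: "(nat \<Rightarrow> nat \<Rightarrow> real) \<Rightarrow> nat set \<Rightarrow> nat set \<Rightarrow> real" where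
  "coalition_value a I T = (if I = {} then 0 else \<Sum>j\<in>T. Max ((\<lambda>i. a i j) ` I))"

definition locally_financed ::
  "nat \<Rightarrow> (nat \<Rightarrow> nat \<Rightarrow> real) \<Rightarrow> (nat \<Rightarrow> nat set) \<Rightarrow> (nat \<Rightarrow> real) \<Rightarrow> (nat \<Rightarrow> real) \<Rightarrow> bool" where
  "locally_financed m a X x y \<longleftrightarrow>
     (\<forall>i\<in>firms m. x i + (\<Sum>j\<in>X i. y j) = firm_value a i (X i))"

(* The blocking inequalities constrain only the payoffs (x, y); the matching X is carried
   along as a component of the outcome, and its feasibility is a separate condition. *)
definition alpha_core ::
  "nat \<Rightarrow> nat \<Rightarrow> (nat \<Rightarrow> nat \<Rightarrow> real) \<Rightarrow> real
    \<Rightarrow> ((nat \<Rightarrow> nat set) \<times> (nat \<Rightarrow> real) \<times> (nat \<Rightarrow> real)) set" where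
  "alpha_core m n a \<alpha> =
     {(X, x, y). \<forall>I T. I \<subseteq> firms m \<longrightarrow> T \<subseteq> workers n \<longrightarrow>
        (\<Sum>i\<in>I. x i) + (\<Sum>j\<in>T. y j) \<ge> \<alpha> * coalition_value a I T}"

definition pos_part :: "real \<Rightarrow> real" where
  "pos_part u = max u 0"

end

theory Submission
  imports Defs
begin

text \<open>Blocking by a single firm \<open>i\<close> with a set \<open>T\<close> of workers is exactly the stated inequality. Conversely,
  when a coalition assigns each worker \<open>j\<close> to a most productive firm of \<open>I\<close>, the surplus
  \<open>\<alpha> * Max - y j\<close> is one of the summands of \<open>\<Sum>i\<in>I. [\<alpha> * a i j - y j]\<^sub>+\<close>; so summing the single-firm
  inequalities over \<open>I\<close> rules out all larger coalitions.\<close>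

lemma pos_part_nonneg: "0 \<le> pos_part u"
  by (simp add: pos_part_def)

lemma le_pos_part: "u \<le> pos_part u"
  by (simp add: pos_part_def)

lemma sum_pos_part_mono:
  assumes "finite A" "T \<subseteq> A"
  shows "(\<Sum>j\<in>T. pos_part (f j)) \<le> (\<Sum>j\<in>A. pos_part (f j))"
  using assms by (intro sum_mono2) (auto simp: pos_part_nonneg)

text \<open>Replacing each term by its positive part and then enlarging \<open>T\<close> to
  \<open>A\<close> never decreases the sum, which gives the upper bound. It is attained by keeping
  exactly the indices where \<open>f\<close> is nonnegative.\<close>

lemma Max_sum_Pow_eq_sum_pos_part:
  fixes f :: "'a \<Rightarrow> real"
  assumes A: "finite A"
  shows "Max ((\<lambda>T. \<Sum>j\<in>T. f j) ` Pow A) = (\<Sum>j\<in>A. pos_part (f j))"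
proof (rule Max_eqI)
  show "finite ((\<lambda>T. \<Sum>j\<in>T. f j) ` Pow A)"
    using A by simp
  fix s
  assume "s \<in> (\<lambda>T. \<Sum>j\<in>T. f j) ` Pow A"
  then obtain T where T: "T \<subseteq> A" and s: "s = (\<Sum>j\<in>T. f j)"
    by auto
  have "s \<le> (\<Sum>j\<in>T. pos_part (f j))"
    unfolding s by (intro sum_mono le_pos_part)
  also have "\<dots> \<le> (\<Sum>j\<in>A. pos_part (f j))"
    using A T by (rule sum_pos_part_mono)
  finally show "s \<le> (\<Sum>j\<in>A. pos_part (f j))" .
next
  \<comment> \<open>The maximizing subset is \<open>{j \<in> A. 0 \<le> f j}\<close>;
    \<open>sum.inter_filter\<close> rewrites its sum as a sum over \<open>A\<close> with zeros
    elsewhere, which agrees termwise with \<open>pos_part\<close>.\<close>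
  have "(\<Sum>j\<in>A. pos_part (f j)) = (\<Sum>j\<in>{j \<in> A. 0 \<le> f j}. f j)"
    unfolding sum.inter_filter[OF A] by (intro sum.cong) (auto simp: pos_part_def)
  then show "(\<Sum>j\<in>A. pos_part (f j)) \<in> (\<lambda>T. \<Sum>j\<in>T. f j) ` Pow A"
    by (intro image_eqI) auto
qed

lemma coalition_value_singleton: "coalition_value a {i} T = (\<Sum>j\<in>T. a i j)"
  by (simp add: coalition_value_def)

lemma coalition_surplus_le:
  assumes "finite I" "I \<noteq> {}"
  shows "\<alpha> * coalition_value a I T - (\<Sum>j\<in>T. y j)
    \<le> (\<Sum>i\<in>I. \<Sum>j\<in>T. pos_part (\<alpha> * a i j - y j))"
proof -
  have pointwise: "\<alpha> * Max ((\<lambda>i. a i j) ` I) - y j \<le> (\<Sum>i\<in>I. pos_part (\<alpha> * a i j - y j))" for j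
  proof -
    \<comment> \<open>The maximizing firm varies with \<open>j\<close>; bounding by the sum over all
      of \<open>I\<close> makes the estimate uniform in that choice, at the cost of extra
      nonnegative terms.\<close>
    have "Max ((\<lambda>i. a i j) ` I) \<in> (\<lambda>i. a i j) ` I"
      using assms by (intro Max_in) auto
    then obtain i where i: "i \<in> I" and max: "Max ((\<lambda>i. a i j) ` I) = a i j"
      by auto
    have "\<alpha> * a i j - y j \<le> pos_part (\<alpha> * a i j - y j)"
      by (rule le_pos_part)
    also have "\<dots> \<le> (\<Sum>i\<in>I. pos_part (\<alpha> * a i j - y j))"
      using assms i by (intro member_le_sum) (auto simp: pos_part_nonneg)
    finally show ?thesis
      unfolding max .
  qed
  have "\<alpha> * coalition_value a I T - (\<Sum>j\<in>T. y j) = (\<Sum>j\<in>T. \<alpha> * Max ((\<lambda>i. a i j) ` I) - y j)"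
    using assms by (simp add: coalition_value_def sum_distrib_left sum_subtractf)
  also have "\<dots> \<le> (\<Sum>j\<in>T. \<Sum>i\<in>I. pos_part (\<alpha> * a i j - y j))"
    by (intro sum_mono pointwise)
  also have "\<dots> = (\<Sum>i\<in>I. \<Sum>j\<in>T. pos_part (\<alpha> * a i j - y j))"
    by (rule sum.swap)
  finally show ?thesis .
qed

text \<open>This is the core inequality for the coalition of \<open>{i}\<close> and
  \<open>T\<close>: the maximum over one firm collapses to \<open>a i j\<close>, and the wages move
  to the other side.\<close>

lemma alpha_core_firm_inequality:
  assumes core: "(X, x, y) \<in> alpha_core m n a \<alpha>" and "i \<in> firms m" "T \<subseteq> workers n"
  shows "(\<Sum>j\<in>T. \<alpha> * a i j - y j) \<le> x i"
proof -
  have "\<alpha> * coalition_value a {i} T \<le> (\<Sum>i\<in>{i}. x i) + (\<Sum>j\<in>T. y j)"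
    using assms unfolding alpha_core_def by blast
  then show ?thesis
    by (simp add: coalition_value_singleton sum_subtractf sum_distrib_left)
qed

text \<open>The bound on \<open>x i\<close> does not depend on \<open>T\<close>, so one inequality
  per firm serves every coalition: enlarging \<open>T\<close> to all workers adds only nonnegative
  terms.\<close>

lemma alpha_coreI:
  assumes y: "\<And>j. j \<in> workers n \<Longrightarrow> 0 \<le> y j"
    and x: "\<And>i. i \<in> firms m \<Longrightarrow> (\<Sum>j\<in>workers n. pos_part (\<alpha> * a i j - y j)) \<le> x i"
  shows "(X, x, y) \<in> alpha_core m n a \<alpha>"
proof -
  have "\<alpha> * coalition_value a I T \<le> (\<Sum>i\<in>I. x i) + (\<Sum>j\<in>T. y j)"
    if I: "I \<subseteq> firms m" and T: "T \<subseteq> workers n" for I T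
  proof (cases "I = {}")
    case True
    \<comment> \<open>Without firms the coalition value is 0 by convention, so the claim reduces to
      nonnegativity of the wages.\<close>
    have "0 \<le> (\<Sum>j\<in>T. y j)"
      using T y by (intro sum_nonneg) auto
    with True show ?thesis
      by (simp add: coalition_value_def)
  next
    case False
    have "finite I"
      using I by (rule finite_subset) (simp add: firms_def)
    then have "\<alpha> * coalition_value a I T - (\<Sum>j\<in>T. y j)
        \<le> (\<Sum>i\<in>I. \<Sum>j\<in>T. pos_part (\<alpha> * a i j - y j))"
      using False by (rule coalition_surplus_le)
    also have "\<dots> \<le> (\<Sum>i\<in>I. \<Sum>j\<in>workers n. pos_part (\<alpha> * a i j - y j))"
      using T by (intro sum_mono sum_pos_part_mono) (auto simp: workers_def)
    also have "\<dots> \<le> (\<Sum>i\<in>I. x i)"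
      using I x by (intro sum_mono) auto
    finally show ?thesis
      by simp
  qed
  then show ?thesis
    unfolding alpha_core_def by blast
qed

theorem lemma1:
  fixes m n :: nat
    and a :: "nat \<Rightarrow> nat \<Rightarrow> real"
    and X :: "nat \<Rightarrow> nat set"
    and \<alpha> :: real
    and x y :: "nat \<Rightarrow> real"
  assumes "\<And>i j. i \<in> firms m \<Longrightarrow> j \<in> workers n \<Longrightarrow> a i j \<ge> 0"
    and "complete_matching m n X"
    and "\<alpha> \<ge> 0"
    and "\<And>i. i \<in> firms m \<Longrightarrow> x i \<ge> 0"
    and "\<And>j. j \<in> workers n \<Longrightarrow> y j \<ge> 0"
    and "locally_financed m a X x y"
  shows "((X, x, y) \<in> alpha_core m n a \<alpha> \<longleftrightarrow>
           (\<forall>i\<in>firms m. x i \<ge> Max ((\<lambda>T. \<Sum>j\<in>T. (\<alpha> * a i j - y j)) ` Pow (workers n))))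
       \<and> (\<forall>i\<in>firms m. Max ((\<lambda>T. \<Sum>j\<in>T. (\<alpha> * a i j - y j)) ` Pow (workers n))
            = (\<Sum>j\<in>workers n. pos_part (\<alpha> * a i j - y j)))"
proof -
  have fin: "finite (workers n)"
    by (simp add: workers_def)
  have eq: "Max ((\<lambda>T. \<Sum>j\<in>T. (\<alpha> * a i j - y j)) ` Pow (workers n))
      = (\<Sum>j\<in>workers n. pos_part (\<alpha> * a i j - y j))" for i
    using fin by (rule Max_sum_Pow_eq_sum_pos_part)
  have "Max ((\<lambda>T. \<Sum>j\<in>T. (\<alpha> * a i j - y j)) ` Pow (workers n)) \<le> x i"
    if "(X, x, y) \<in> alpha_core m n a \<alpha>" "i \<in> firms m" for i
    \<comment> \<open>\<open>Pow (workers n)\<close> is finite and nonempty, so bounding the maximum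
      amounts to bounding the sum for each \<open>T\<close>.\<close>
    using fin alpha_core_firm_inequality[OF that] by (subst Max_le_iff) auto
  moreover have "(X, x, y) \<in> alpha_core m n a \<alpha>"
    if "\<forall>i\<in>firms m. Max ((\<lambda>T. \<Sum>j\<in>T. (\<alpha> * a i j - y j)) ` Pow (workers n)) \<le> x i"
    using that assms(5) unfolding eq by (intro alpha_coreI) auto
  ultimately show ?thesis
    using eq by blast
qed

end
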